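(* Let $G$ be a finite simple connected graph with at least two vertices. If $G$ is super-$\lambda$ and $r$-regular for some $r$, and $G\ncong K_2$, then $X(G)\cong G$.
   Context: All graphs are finite and simple. For a connected graph $G$, an edge-cut of $G$ is a subset $S\subseteq E(G)$ such that $G-S$ is disconnected; a mincut of $G$ is an edge-cut of minimum cardinality, and this cardinality is the edge-connectivity $\lambda(G)$. The mincut graph $X(G)$ of $G$ is the intersection graph of the mincuts: it has one vertex for each mincut of $G$, and two distinct vertices are adjacent if and only if the corresponding mincuts have non-empty intersection (as sets of edges). A graph $G$ is super-$\lambda$ if every mincut of $G$ is trivial, that is, consists of all the edges incident on some vertex of minimum degree. *)

theory Defs
  imports "Graph_Theory.Graph_Theory"
begin

text \<open>
  A finite simple graph is a \<^locale>\<open>pair_graph\<close>: a finite, loopless, symmetric set of arcs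
  on a finite vertex set. Each undirected edge is a pair of opposite arcs there, so edge sets,
  edge-cuts and their cardinalities are formulated with two-element vertex sets instead.
\<close>

definition edges :: "'a pair_pre_digraph \<Rightarrow> 'a set set" where
  "edges G = {{u, v} | u v. (u, v) \<in> parcs G}"

definition delete_edges :: "'a pair_pre_digraph \<Rightarrow> 'a set set \<Rightarrow> 'a pair_pre_digraph" where
  "delete_edges G S = \<lparr> pverts = pverts G, parcs = {(u, v) \<in> parcs G. {u, v} \<notin> S} \<rparr>"

definition incident_edges :: "'a pair_pre_digraph \<Rightarrow> 'a \<Rightarrow> 'a set set" where
  "incident_edges G v = {e \<in> edges G. v \<in> e}"

definition degree :: "'a pair_pre_digraph \<Rightarrow> 'a \<Rightarrow> nat" where
  "degree G v = card (incident_edges G v)"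

definition regular :: "nat \<Rightarrow> 'a pair_pre_digraph \<Rightarrow> bool" where
  "regular r G \<longleftrightarrow> (\<forall>v \<in> pverts G. degree G v = r)"

definition edge_cut :: "'a pair_pre_digraph \<Rightarrow> 'a set set \<Rightarrow> bool" where
  "edge_cut G S \<longleftrightarrow> S \<subseteq> edges G \<and> \<not> connected (with_proj (delete_edges G S))"

text \<open>
  The following value is meaningful only if \<open>G\<close> has an edge-cut, which holds for every
  finite simple graph with at least two vertices.
\<close>

definition edge_connectivity :: "'a pair_pre_digraph \<Rightarrow> nat" where
  "edge_connectivity G = (LEAST k. \<exists>S. edge_cut G S \<and> card S = k)"

definition mincut :: "'a pair_pre_digraph \<Rightarrow> 'a set set \<Rightarrow> bool" where
  "mincut G S \<longleftrightarrow> edge_cut G S \<and> card S = edge_connectivity G"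

definition mincut_graph :: "'a pair_pre_digraph \<Rightarrow> 'a set set pair_pre_digraph" where
  "mincut_graph G =
    \<lparr> pverts = {S. mincut G S},
      parcs = {(S, T). mincut G S \<and> mincut G T \<and> S \<noteq> T \<and> S \<inter> T \<noteq> {}} \<rparr>"

definition min_degree_vertex :: "'a pair_pre_digraph \<Rightarrow> 'a \<Rightarrow> bool" where
  "min_degree_vertex G v \<longleftrightarrow> v \<in> pverts G \<and> (\<forall>u \<in> pverts G. degree G v \<le> degree G u)"

definition super_lambda :: "'a pair_pre_digraph \<Rightarrow> bool" where
  "super_lambda G \<longleftrightarrow>
    (\<forall>S. mincut G S \<longrightarrow> (\<exists>v. min_degree_vertex G v \<and> S = incident_edges G v))"

lemma (in pair_graph) finite_edges: "finite (edges G)"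
proof -
  have "edges G = (\<lambda>(u, v). {u, v}) ` parcs G"
    by (auto simp: edges_def)
  then show ?thesis
    by (simp add: pair_finite_arcs)
qed

lemma (in pair_graph) degree_eq_out_degree: "degree G v = out_degree (with_proj G) v"
proof -
  have sym: "(v, u) \<in> parcs G" if "(u, v) \<in> parcs G" for u v
    using pair_sym_arcs that by (auto simp: symmetric_def dest: symD)
  have "bij_betw (\<lambda>(u, w). {u, w}) {a \<in> parcs G. fst a = v} (incident_edges G v)"
    unfolding bij_betw_def
  proof
    show "inj_on (\<lambda>(u, w). {u, w}) {a \<in> parcs G. fst a = v}"
      by (auto simp: inj_on_def doubleton_eq_iff)
    show "(\<lambda>(u, w). {u, w}) ` {a \<in> parcs G. fst a = v} = incident_edges G v"
    proof
      show "(\<lambda>(u, w). {u, w}) ` {a \<in> parcs G. fst a = v} \<subseteq> incident_edges G v"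
        by (auto simp: incident_edges_def edges_def)
      show "incident_edges G v \<subseteq> (\<lambda>(u, w). {u, w}) ` {a \<in> parcs G. fst a = v}"
      proof
        fix e assume "e \<in> incident_edges G v"
        then obtain u w where e: "e = {u, w}" "(u, w) \<in> parcs G" and "v = u \<or> v = w"
          unfolding incident_edges_def edges_def by blast
        then obtain x where "e = {v, x}" "(v, x) \<in> parcs G"
          using sym insert_commute by metis
        then show "e \<in> (\<lambda>(u, w). {u, w}) ` {a \<in> parcs G. fst a = v}"
          by (intro image_eqI[where x = "(v, x)"]) simp_all
      qed
    qed
  qed
  then show ?thesis
    by (simp add: degree_def out_degree_def out_arcs_def bij_betw_same_card)
qed

lemma (in pair_graph) pair_graph_mincut_graph: "pair_graph (mincut_graph G)"
proof -
  have "{S. mincut G S} \<subseteq> Pow (edges G)"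
    by (auto simp: mincut_def edge_cut_def)
  then have fin: "finite {S. mincut G S}"
    by (rule finite_subset) (simp add: finite_edges)
  have "parcs (mincut_graph G) \<subseteq> {S. mincut G S} \<times> {S. mincut G S}"
    by (auto simp: mincut_graph_def)
  then have "finite (parcs (mincut_graph G))"
    by (rule finite_subset) (simp add: fin)
  then show ?thesis
    using fin by unfold_locales (auto simp: mincut_graph_def symmetric_def sym_def)
qed

end

theory Submission
  imports Defs
begin

text \<open>
  Isolating a vertex is an edge-cut, and some vertex star is a mincut because \<open>G\<close> is
  super-\<open>\<lambda>\<close>. By regularity all stars have the same size, so the mincuts are exactly the
  vertex stars. Two distinct stars meet precisely when their centres are adjacent, and if
  two stars coincide then no edge leaves their two centres, so a connected \<open>G\<close> is \<open>K\<^sub>2\<close>.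
\<close>

text \<open>A walk from \<open>u\<close> to \<open>v\<close> has to leave \<open>X\<close> at some
  step. \<open>connected\<close> refers to the symmetric closure of the arcs, so the crossing step
  may be an arc in either direction.\<close>

lemma connected_crossing_arc:
  assumes "connected (with_proj H)" "u \<in> pverts H" "v \<in> pverts H" "u \<in> X" "v \<notin> X"
  obtains a b where "a \<in> X" "b \<notin> X" "(a, b) \<in> parcs H \<or> (b, a) \<in> parcs H"
proof -
  have "(u, v) \<in> rtrancl_on (pverts H) (parcs (mk_symmetric (with_proj H)))"
    using assms(1-3) by (auto simp: connected_def strongly_connected_def reachable_def)
  \<comment> \<open>The condition on the endpoint belongs to the induction statement because
    intermediate vertices of the walk may still lie in \<open>X\<close>.\<close>
  then have "v \<notin> X \<longrightarrow> (\<exists>a b. a \<in> X \<and> b \<notin> X \<and> (a, b) \<in> parcs (mk_symmetric (with_proj H)))"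
    using assms(4) by induction auto
  then show thesis
    using assms(5) that by (auto simp: parcs_mk_symmetric)
qed

text \<open>An arc is the pair of its ends, so \<open>g\<close> forces the arc map to be
  \<open>map_prod g g\<close>; its bijectivity follows from that of \<open>g\<close>, as all arcs
  join vertices of the graph.\<close>

lemma digraph_iso_with_projI:
  assumes "pair_wf_digraph H" "pair_wf_digraph G"
    and bij: "bij_betw g (pverts H) (pverts G)"
    and arcs: "\<And>u v. u \<in> pverts H \<Longrightarrow> v \<in> pverts H \<Longrightarrow>
      (u, v) \<in> parcs H \<longleftrightarrow> (g u, g v) \<in> parcs G"
  shows "digraph_iso (with_proj H) (with_proj G)"
proof -
  interpret H: pair_wf_digraph H by fact
  interpret G: pair_wf_digraph G by fact
  let ?f = "\<lparr> iso_verts = g, iso_arcs = map_prod g g, iso_head = snd, iso_tail = fst \<rparr>"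
  have inj: "inj_on g (pverts H)" and img: "g ` pverts H = pverts G"
    using bij by (auto simp: bij_betw_def)
  have "inj_on (map_prod g g) (pverts H \<times> pverts H)"
    using inj by (rule map_prod_inj_on[OF _ inj])
  moreover have sub: "parcs H \<subseteq> pverts H \<times> pverts H"
    by (auto dest: H.in_arcsD1 H.in_arcsD2)
  ultimately have inj_arcs: "inj_on (map_prod g g) (parcs H)"
    by (rule inj_on_subset)
  have img_arcs: "map_prod g g ` parcs H = parcs G"
  proof
    show "map_prod g g ` parcs H \<subseteq> parcs G"
      using arcs sub by auto
    show "parcs G \<subseteq> map_prod g g ` parcs H"
    proof
      fix e assume e: "e \<in> parcs G"
      obtain x y where xy: "e = (x, y)" by (cases e)
      then have "x \<in> g ` pverts H" "y \<in> g ` pverts H"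
        using e img by (auto dest: G.in_arcsD1 G.in_arcsD2)
      then obtain u v where "u \<in> pverts H" "v \<in> pverts H" "x = g u" "y = g v"
        by auto
      then show "e \<in> map_prod g g ` parcs H"
        using arcs e xy by (intro image_eqI[where x = "(u, v)"]) auto
    qed
  qed
  have "pre_digraph.digraph_isomorphism (with_proj H) ?f"
    using inj inj_arcs H.wf_digraph by (auto simp: pre_digraph.digraph_isomorphism_def)
  moreover have "with_proj G = app_iso ?f (with_proj H)"
    by (simp add: app_iso_def with_proj_def img img_arcs)
  ultimately show ?thesis
    by (auto simp: digraph_iso_def)
qed

context pair_graph
begin

lemma edge_in_edges_iff: "{u, v} \<in> edges G \<longleftrightarrow> (u, v) \<in> parcs G"
  using pair_sym_arcs by (auto simp: edges_def doubleton_eq_iff symmetric_def dest: symD)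

lemma incident_edges_cases:
  assumes "e \<in> incident_edges G v"
  obtains w where "e = {v, w}" "(v, w) \<in> parcs G"
proof -
  obtain x y where "e = {x, y}" "{x, y} \<in> edges G" "v = x \<or> v = y"
    using assms by (auto simp: incident_edges_def edges_def)
  then show thesis
    using that edge_in_edges_iff by (metis insert_commute)
qed

lemma arc_in_incident_edges:
  assumes "(u, v) \<in> parcs G"
  shows "{u, v} \<in> incident_edges G u" "{u, v} \<in> incident_edges G v"
  using assms by (auto simp: incident_edges_def edge_in_edges_iff)

text \<open>After the deletion no arc crosses between \<open>u\<close> and the rest, which contains
  \<open>v\<close>.\<close>

lemma edge_cut_incident_edges:
  assumes "u \<in> pverts G" "v \<in> pverts G" "u \<noteq> v"
  shows "edge_cut G (incident_edges G u)"
proof -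
  let ?H = "delete_edges G (incident_edges G u)"
  have "\<not> connected (with_proj ?H)"
  proof
    assume "connected (with_proj ?H)"
    moreover have "u \<in> pverts ?H" "v \<in> pverts ?H" "u \<in> {u}" "v \<notin> {u}"
      using assms by (auto simp: delete_edges_def)
    ultimately obtain a b where "a \<in> {u}" "(a, b) \<in> parcs ?H \<or> (b, a) \<in> parcs ?H"
      by (rule connected_crossing_arc)
    then show False
      using arc_in_incident_edges by (auto simp: delete_edges_def)
  qed
  then show ?thesis
    by (auto simp: edge_cut_def incident_edges_def)
qed

text \<open>The only edge that can contain two distinct vertices is the one joining them.\<close>

lemma incident_edges_meet_iff:
  assumes "u \<noteq> v"
  shows "incident_edges G u \<inter> incident_edges G v \<noteq> {} \<longleftrightarrow> (u, v) \<in> parcs G"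
proof
  assume "incident_edges G u \<inter> incident_edges G v \<noteq> {}"
  then obtain e where "e \<in> incident_edges G u" "v \<in> e"
    by (auto simp: incident_edges_def)
  then show "(u, v) \<in> parcs G"
    using assms by (auto elim: incident_edges_cases)
qed (use arc_in_incident_edges in blast)

lemma inj_on_incident_edges:
  assumes conn: "connected (with_proj G)" and not_K2: "\<not> complete_digraph 2 (with_proj G)"
  shows "inj_on (incident_edges G) (pverts G)"
proof (rule inj_onI, rule ccontr)
  fix u v
  assume u: "u \<in> pverts G" and v: "v \<in> pverts G"
    and eq: "incident_edges G u = incident_edges G v" and "u \<noteq> v"
  have arc: "(a, b) \<in> parcs G" if "(a, b) \<in> parcs G \<or> (b, a) \<in> parcs G" for a b
    using that edge_in_edges_iff by (metis insert_commute)
  \<comment> \<open>An edge at one of the two centres lies in both stars, hence contains both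
    centres.\<close>
  have both: "u \<in> {a, b}" "v \<in> {a, b}"
    if "a \<in> {u, v}" "(a, b) \<in> parcs G" for a b
  proof -
    have "{a, b} \<in> incident_edges G u \<inter> incident_edges G v"
      using that eq arc_in_incident_edges(1) by auto
    then show "u \<in> {a, b}" "v \<in> {a, b}"
      by (auto simp: incident_edges_def)
  qed
  \<comment> \<open>A third vertex would force an edge out of \<open>{u, v}\<close>, against
    \<open>both\<close>.\<close>
  have "w \<in> {u, v}" if w: "w \<in> pverts G" for w
  proof (rule ccontr)
    assume notin: "w \<notin> {u, v}"
    obtain a b where "a \<in> {u, v}" "b \<notin> {u, v}" "(a, b) \<in> parcs G \<or> (b, a) \<in> parcs G"
      by (rule connected_crossing_arc[OF conn u w insertI1 notin])
    then show False
      using both[of a b] arc[of a b] \<open>u \<noteq> v\<close> by auto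
  qed
  then have verts: "pverts G = {u, v}"
    using u v by auto
  have "v \<notin> {u}"
    using \<open>u \<noteq> v\<close> by simp
  \<comment> \<open>Connectedness also yields an edge at \<open>u\<close>; by \<open>both\<close>
    its other end is \<open>v\<close>.\<close>
  then obtain a b where "a \<in> {u}" "(a, b) \<in> parcs G \<or> (b, a) \<in> parcs G"
    by (rule connected_crossing_arc[OF conn u v insertI1])
  then have "(u, b) \<in> parcs G"
    using arc by auto
  then have "(u, v) \<in> parcs G"
    using both(2)[of u b] \<open>u \<noteq> v\<close> by auto
  then have "(u, v) \<in> parcs G" "(v, u) \<in> parcs G"
    using arc by auto
  moreover have "x \<in> {u, v} \<and> y \<in> {u, v} \<and> x \<noteq> y" if "(x, y) \<in> parcs G" for x y
    using in_arcsD1[OF that] in_arcsD2[OF that] pair_no_loops[OF that] verts by simp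
  ultimately have "parcs G = {(x, y). (x, y) \<in> pverts G \<times> pverts G \<and> x \<noteq> y}"
    unfolding verts by blast
  then have "complete_digraph 2 (with_proj G)"
    using verts \<open>u \<noteq> v\<close> pair_graphD_graph by (simp add: complete_digraph_def)
  with not_K2 show False ..
qed

lemma mincut_regular_super_lambda:
  assumes card: "card (pverts G) \<ge> 2" and super: "super_lambda G" and reg: "regular r G"
  shows "{S. mincut G S} = incident_edges G ` pverts G"
proof -
  have cut: "edge_cut G (incident_edges G u)" if "u \<in> pverts G" for u
  proof -
    have "\<not> pverts G \<subseteq> {u}"
      using card card_mono[of "{u}" "pverts G"] by auto
    then show ?thesis
      using that edge_cut_incident_edges by blast
  qed
  have sub: "{S. mincut G S} \<subseteq> incident_edges G ` pverts G"
    using super by (auto simp: super_lambda_def min_degree_vertex_def)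
  obtain u where "u \<in> pverts G"
    using card by fastforce
  \<comment> \<open>\<open>edge_connectivity\<close> is a \<open>LEAST\<close>, so some edge-cut
    must be exhibited before its value is known to be attained.\<close>
  then have "\<exists>k S. edge_cut G S \<and> card S = k"
    using cut by blast
  then have "\<exists>S. edge_cut G S \<and> card S = edge_connectivity G"
    unfolding edge_connectivity_def by (rule LeastI_ex)
  then obtain S where "mincut G S"
    by (auto simp: mincut_def)
  \<comment> \<open>The mincut \<open>S\<close> is itself a star, and every star has
    \<open>r\<close> edges.\<close>
  then have "edge_connectivity G = r"
    using sub reg by (auto simp: mincut_def regular_def degree_def)
  then have "incident_edges G ` pverts G \<subseteq> {S. mincut G S}"
    using cut reg by (auto simp: mincut_def regular_def degree_def)
  with sub show ?thesis ..
qed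

end

theorem corollary4p4:
  fixes G :: "'a pair_pre_digraph" and r :: nat
  assumes "pair_graph G"
    and "connected (with_proj G)"
    and "card (pverts G) \<ge> 2"
    and "super_lambda G"
    and "regular r G"
    and "\<not> complete_digraph 2 (with_proj G)"
  shows "digraph_iso (with_proj (mincut_graph G)) (with_proj G)"
proof -
  interpret G: pair_graph G by fact
  interpret X: pair_graph "mincut_graph G" by (rule G.pair_graph_mincut_graph)
  let ?star = "incident_edges G"
  have inj: "inj_on ?star (pverts G)"
    using assms G.inj_on_incident_edges by simp
  have mincuts: "{S. mincut G S} = ?star ` pverts G"
    using assms G.mincut_regular_super_lambda by simp
  then have verts: "pverts (mincut_graph G) = ?star ` pverts G"
    by (simp add: mincut_graph_def)
  have arcs: "(?star u, ?star v) \<in> parcs (mincut_graph G) \<longleftrightarrow> (u, v) \<in> parcs G"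
    if "u \<in> pverts G" "v \<in> pverts G" for u v
  proof (cases "u = v")
    case True
    then show ?thesis
      using X.pair_no_loops G.pair_no_loops by fastforce
  next
    case False
    \<comment> \<open>Adjacency of mincuts demands that they differ as sets, which is where
      injectivity enters.\<close>
    then have "?star u \<noteq> ?star v"
      using inj that by (auto dest: inj_onD)
    moreover have "mincut G (?star u)" "mincut G (?star v)"
      using mincuts that by auto
    ultimately show ?thesis
      using G.incident_edges_meet_iff[OF False] by (simp add: mincut_graph_def)
  qed
  show ?thesis
  proof (rule digraph_iso_with_projI)
    \<comment> \<open>The isomorphism starts from the mincut graph, so it sends each star back to
      its centre.\<close>
    show "bij_betw (the_inv_into (pverts G) ?star) (pverts (mincut_graph G)) (pverts G)"
      using inj verts by (simp add: bij_betw_the_inv_into inj_on_imp_bij_betw)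
    show "(S, T) \<in> parcs (mincut_graph G) \<longleftrightarrow>
      (the_inv_into (pverts G) ?star S, the_inv_into (pverts G) ?star T) \<in> parcs G"
      if "S \<in> pverts (mincut_graph G)" "T \<in> pverts (mincut_graph G)" for S T
      using that arcs inj by (auto simp: verts the_inv_into_f_f)
  qed unfold_locales
qed

end
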